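(* Let $G$ be a group with a central involution $\sharp$, and let $\varepsilon,\mu\in Z(G)$ be elements of the center, fixed under $\sharp$, with $\varepsilon^2=e$ ($e$ the neutral element). On the double $D(G)=G\times\mathbb{Z}/2\mathbb{Z}=G_0\sqcup G_1$ (write $x_i=(x,i)$) define a product $\bullet$ and a map $\sharp:D(G)\to D(G)$ by $$x_0\bullet y_0=(xy)_0,\quad x_0\bullet y_1=(yx)_1,\quad x_1\bullet y_0=(xy^\sharp)_1,\quad x_1\bullet y_1=(\mu\varepsilon\, y^\sharp x)_0,$$ $$(x_0)^\sharp=(x^\sharp)_0,\qquad (x_1)^\sharp=(\varepsilon x)_1 .$$ Then: \begin{enumerate} \item If $G$ is commutative and $\sharp$ (on $G$) is trivial, then $D(G)$ is a commutative group. \item If $G$ is commutative but $\sharp$ (on $G$) is non-trivial, then $D(G)$ is a non-commutative group. \item If $G$ is not commutative, then $(D(G),\bullet)$ is a non-associative Moufang loop. \end{enumerate} In any case, the new map $\sharp:D(G)\to D(G)$ is again a central involution, and it is related to the inversion map by $x^{-1}=(x^\sharp x)^{-1}x^\sharp$ for all $x\in D(G)$, where $(x^\sharp x)^{-1}$ is the (group) inverse in the center of $D(G)$.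
   Context: An involution of a group or loop is an anti-automorphism $\sharp$ with $\sharp\circ\sharp=\mathrm{id}$ (the identity map is allowed when the group is commutative). It is central if $gg^\sharp=g^\sharp g$ lies in the center for all $g$. The center of a loop is the set of elements that commute and associate with all other elements. A Moufang loop is a set with a binary product having a unit element and all left and right multiplications bijective, such that the Moufang identity $(ax)(ya)=a((xy)a)$ holds (equivalently $z(x(zy))=((zx)z)y$); every element $x$ then has a two-sided inverse $x^{-1}$. *)

theory Defs
  imports "HOL-Algebra.Group" "HOL-Library.Z2"
begin

locale loop =
  fixes L (structure)
  assumes m_closed: "\<lbrakk>x \<in> carrier L; y \<in> carrier L\<rbrakk> \<Longrightarrow> x \<otimes> y \<in> carrier L"
    and one_closed: "\<one> \<in> carrier L"
    and l_one: "x \<in> carrier L \<Longrightarrow> \<one> \<otimes> x = x"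
    and r_one: "x \<in> carrier L \<Longrightarrow> x \<otimes> \<one> = x"
    and left_mult_bij: "a \<in> carrier L \<Longrightarrow> bij_betw (\<lambda>x. a \<otimes> x) (carrier L) (carrier L)"
    and right_mult_bij: "a \<in> carrier L \<Longrightarrow> bij_betw (\<lambda>x. x \<otimes> a) (carrier L) (carrier L)"

locale moufang_loop = loop +
  assumes moufang:
    "\<lbrakk>a \<in> carrier L; x \<in> carrier L; y \<in> carrier L\<rbrakk> \<Longrightarrow>
      (a \<otimes> x) \<otimes> (y \<otimes> a) = a \<otimes> ((x \<otimes> y) \<otimes> a)"

definition associative_op :: "('a, 'b) monoid_scheme \<Rightarrow> bool" where
  "associative_op L \<longleftrightarrow>
    (\<forall>x\<in>carrier L. \<forall>y\<in>carrier L. \<forall>z\<in>carrier L.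
      (x \<otimes>\<^bsub>L\<^esub> y) \<otimes>\<^bsub>L\<^esub> z = x \<otimes>\<^bsub>L\<^esub> (y \<otimes>\<^bsub>L\<^esub> z))"

text \<open>For a group the three association conditions are automatic, so this is also the
  usual center of a group.\<close>

definition center :: "('a, 'b) monoid_scheme \<Rightarrow> 'a set" where
  "center L = {z \<in> carrier L.
    (\<forall>x\<in>carrier L. z \<otimes>\<^bsub>L\<^esub> x = x \<otimes>\<^bsub>L\<^esub> z) \<and>
    (\<forall>x\<in>carrier L. \<forall>y\<in>carrier L.
      (z \<otimes>\<^bsub>L\<^esub> x) \<otimes>\<^bsub>L\<^esub> y = z \<otimes>\<^bsub>L\<^esub> (x \<otimes>\<^bsub>L\<^esub> y) \<and>
      (x \<otimes>\<^bsub>L\<^esub> z) \<otimes>\<^bsub>L\<^esub> y = x \<otimes>\<^bsub>L\<^esub> (z \<otimes>\<^bsub>L\<^esub> y) \<and>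
      (x \<otimes>\<^bsub>L\<^esub> y) \<otimes>\<^bsub>L\<^esub> z = x \<otimes>\<^bsub>L\<^esub> (y \<otimes>\<^bsub>L\<^esub> z))}"

abbreviation center_struct :: "('a, 'b) monoid_scheme \<Rightarrow> ('a, 'b) monoid_scheme" where
  "center_struct L \<equiv> L\<lparr>carrier := center L\<rparr>"

definition anti_automorphism :: "('a, 'b) monoid_scheme \<Rightarrow> ('a \<Rightarrow> 'a) \<Rightarrow> bool" where
  "anti_automorphism L s \<longleftrightarrow> bij_betw s (carrier L) (carrier L) \<and>
    (\<forall>x\<in>carrier L. \<forall>y\<in>carrier L. s (x \<otimes>\<^bsub>L\<^esub> y) = s y \<otimes>\<^bsub>L\<^esub> s x)"

definition involution :: "('a, 'b) monoid_scheme \<Rightarrow> ('a \<Rightarrow> 'a) \<Rightarrow> bool" where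
  "involution L s \<longleftrightarrow> anti_automorphism L s \<and> (\<forall>x\<in>carrier L. s (s x) = x)"

definition central_involution :: "('a, 'b) monoid_scheme \<Rightarrow> ('a \<Rightarrow> 'a) \<Rightarrow> bool" where
  "central_involution L s \<longleftrightarrow> involution L s \<and>
    (\<forall>g\<in>carrier L. g \<otimes>\<^bsub>L\<^esub> s g = s g \<otimes>\<^bsub>L\<^esub> g \<and> g \<otimes>\<^bsub>L\<^esub> s g \<in> center L)"

text \<open>In the double, the pair \<open>(x, i)\<close> with \<open>i :: bit\<close> stands for \<open>x\<^sub>i\<close>.\<close>

fun double_mult ::
  "('a, 'b) monoid_scheme \<Rightarrow> ('a \<Rightarrow> 'a) \<Rightarrow> 'a \<Rightarrow> 'a \<Rightarrow> 'a \<times> bit \<Rightarrow> 'a \<times> bit \<Rightarrow> 'a \<times> bit" where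
  "double_mult G s \<epsilon> \<mu> (x, 0) (y, 0) = (x \<otimes>\<^bsub>G\<^esub> y, 0)"
| "double_mult G s \<epsilon> \<mu> (x, 0) (y, 1) = (y \<otimes>\<^bsub>G\<^esub> x, 1)"
| "double_mult G s \<epsilon> \<mu> (x, 1) (y, 0) = (x \<otimes>\<^bsub>G\<^esub> s y, 1)"
| "double_mult G s \<epsilon> \<mu> (x, 1) (y, 1) = (\<mu> \<otimes>\<^bsub>G\<^esub> \<epsilon> \<otimes>\<^bsub>G\<^esub> s y \<otimes>\<^bsub>G\<^esub> x, 0)"

definition double ::
  "('a, 'b) monoid_scheme \<Rightarrow> ('a \<Rightarrow> 'a) \<Rightarrow> 'a \<Rightarrow> 'a \<Rightarrow> ('a \<times> bit) monoid" where
  "double G s \<epsilon> \<mu> =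
    \<lparr>carrier = carrier G \<times> UNIV, mult = double_mult G s \<epsilon> \<mu>, one = (\<one>\<^bsub>G\<^esub>, 0)\<rparr>"

fun double_sharp ::
  "('a, 'b) monoid_scheme \<Rightarrow> ('a \<Rightarrow> 'a) \<Rightarrow> 'a \<Rightarrow> 'a \<times> bit \<Rightarrow> 'a \<times> bit" where
  "double_sharp G s \<epsilon> (x, 0) = (s x, 0)"
| "double_sharp G s \<epsilon> (x, 1) = (\<epsilon> \<otimes>\<^bsub>G\<^esub> x, 1)"

end

(*
  For x in G the norm s x \<otimes> x is central, so the
  eight parity cases of the Moufang identity in the double reduce to moving norms and the
  constant \<mu> \<otimes> \<epsilon> through a word. Associativity of (x, 0), (y, 0), (\<one>, 1) forces x and y to
  commute, and (x, 0), (\<one>, 1) commute only if s x = x. Norms in the double lie in degree 0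
  and are norms of G up to fixed central factors, hence central; in any loop
  with a central involution, inverses are then obtained by dividing the involution by the norm.
*)
theory Submission
  imports Defs
begin

section \<open>The center of a loop\<close>

context loop
begin

lemma l_cancel:
  "\<lbrakk>a \<in> carrier L; x \<in> carrier L; y \<in> carrier L; a \<otimes> x = a \<otimes> y\<rbrakk> \<Longrightarrow> x = y"
  using left_mult_bij[of a] by (auto simp: bij_betw_def dest: inj_onD)

lemma l_solve: "\<lbrakk>a \<in> carrier L; b \<in> carrier L\<rbrakk> \<Longrightarrow> \<exists>x\<in>carrier L. a \<otimes> x = b"
  using left_mult_bij[of a] by (metis (no_types, lifting) bij_betw_imp_surj_on imageE)

lemma r_solve: "\<lbrakk>a \<in> carrier L; b \<in> carrier L\<rbrakk> \<Longrightarrow> \<exists>x\<in>carrier L. x \<otimes> a = b"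
  using right_mult_bij[of a] by (metis (no_types, lifting) bij_betw_imp_surj_on imageE)

lemma centerD:
  assumes "z \<in> center L"
  shows "z \<in> carrier L"
    and "x \<in> carrier L \<Longrightarrow> z \<otimes> x = x \<otimes> z"
    and "\<lbrakk>x \<in> carrier L; y \<in> carrier L\<rbrakk> \<Longrightarrow> (z \<otimes> x) \<otimes> y = z \<otimes> (x \<otimes> y)"
    and "\<lbrakk>x \<in> carrier L; y \<in> carrier L\<rbrakk> \<Longrightarrow> (x \<otimes> z) \<otimes> y = x \<otimes> (z \<otimes> y)"
    and "\<lbrakk>x \<in> carrier L; y \<in> carrier L\<rbrakk> \<Longrightarrow> (x \<otimes> y) \<otimes> z = x \<otimes> (y \<otimes> z)"
  using assms unfolding center_def by blast+

text \<open>Given commutativity, the third association condition follows from the other two.\<close>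

lemma centerI:
  assumes z: "z \<in> carrier L"
    and comm: "\<And>x. x \<in> carrier L \<Longrightarrow> z \<otimes> x = x \<otimes> z"
    and l: "\<And>x y. \<lbrakk>x \<in> carrier L; y \<in> carrier L\<rbrakk> \<Longrightarrow> (z \<otimes> x) \<otimes> y = z \<otimes> (x \<otimes> y)"
    and m: "\<And>x y. \<lbrakk>x \<in> carrier L; y \<in> carrier L\<rbrakk> \<Longrightarrow> (x \<otimes> z) \<otimes> y = x \<otimes> (z \<otimes> y)"
  shows "z \<in> center L"
proof -
  have "(x \<otimes> y) \<otimes> z = x \<otimes> (y \<otimes> z)" if "x \<in> carrier L" "y \<in> carrier L" for x y
    using that by (metis comm l m m_closed)
  then show ?thesis
    using assms by (simp add: center_def)
qed

lemma one_center: "\<one> \<in> center L"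
  by (rule centerI) (auto simp: one_closed l_one r_one m_closed)

lemma center_m_closed:
  assumes z: "z \<in> center L" and w: "w \<in> center L"
  shows "z \<otimes> w \<in> center L"
proof (rule centerI)
  note c = centerD[OF z] centerD[OF w]
  note car = centerD(1)[OF z] centerD(1)[OF w]
  show "z \<otimes> w \<in> carrier L"
    using car by (simp add: m_closed)
  fix x assume x: "x \<in> carrier L"
  show "z \<otimes> w \<otimes> x = x \<otimes> (z \<otimes> w)"
    using x car c(2)[of x] c(3)[of w x] c(3)[of x w] c(4)[of x w] c(7)[of x] by simp
  fix y assume y: "y \<in> carrier L"
  show "(z \<otimes> w \<otimes> x) \<otimes> y = z \<otimes> w \<otimes> (x \<otimes> y)"
    using x y car by (simp add: c(3,8) m_closed)
  show "(x \<otimes> (z \<otimes> w)) \<otimes> y = x \<otimes> (z \<otimes> w \<otimes> y)"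
  proof -
    have "(x \<otimes> (z \<otimes> w)) \<otimes> y = ((x \<otimes> z) \<otimes> w) \<otimes> y"
      using x car by (simp add: c(4))
    also have "\<dots> = (x \<otimes> z) \<otimes> (w \<otimes> y)"
      using x y car by (simp add: c(9) m_closed)
    also have "\<dots> = x \<otimes> (z \<otimes> (w \<otimes> y))"
      using x y car by (simp add: c(4) m_closed)
    also have "\<dots> = x \<otimes> (z \<otimes> w \<otimes> y)"
      using y car by (simp add: c(3))
    finally show ?thesis .
  qed
qed

text \<open>If \<open>w\<close> solves \<open>z \<otimes> w = \<one>\<close>, then multiplication by
  the central \<open>z\<close> erases a factor \<open>w\<close> standing on either side of an
  element (\<open>wl\<close>, \<open>wm\<close>). Each condition for \<open>w\<close> to be central
  is therefore checked after multiplying by \<open>z\<close>, and \<open>z\<close> is then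
  cancelled.\<close>

lemma center_inverse:
  assumes z: "z \<in> center L"
  shows "\<exists>w\<in>center L. w \<otimes> z = \<one>"
proof -
  note c = centerD[OF z]
  obtain w where w: "w \<in> carrier L" and zw: "z \<otimes> w = \<one>"
    using l_solve[OF c(1) one_closed] by blast
  have wl: "z \<otimes> (w \<otimes> x) = x" if "x \<in> carrier L" for x
    using that w zw c(3)[of w x] by (simp add: l_one)
  have wm: "z \<otimes> (x \<otimes> w) = x" if "x \<in> carrier L" for x
    using that w zw c(2)[of x] c(3)[of x w] c(4)[of x w] by (simp add: r_one)
  have "w \<in> center L"
  proof (rule centerI)
    show "w \<in> carrier L" by fact
    fix x assume x: "x \<in> carrier L"
    show "w \<otimes> x = x \<otimes> w"
      by (rule l_cancel[OF c(1)]) (use x w in \<open>simp_all add: wl wm m_closed\<close>)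
    fix y assume y: "y \<in> carrier L"
    show "(w \<otimes> x) \<otimes> y = w \<otimes> (x \<otimes> y)"
      by (rule l_cancel[OF c(1)]) (use x y w c(3)[of "w \<otimes> x" y, symmetric] in \<open>simp_all add: wl m_closed\<close>)
    show "(x \<otimes> w) \<otimes> y = x \<otimes> (w \<otimes> y)"
    proof (rule l_cancel[OF c(1)])
      have "z \<otimes> (x \<otimes> (w \<otimes> y)) = (x \<otimes> z) \<otimes> (w \<otimes> y)"
        using x y w c(2)[of x] c(3)[of x "w \<otimes> y"] by (simp add: m_closed)
      also have "\<dots> = x \<otimes> y"
        using x y w by (simp add: c(4) wl m_closed)
      also have "\<dots> = z \<otimes> ((x \<otimes> w) \<otimes> y)"
        using x y w c(3)[of "x \<otimes> w" y] by (simp add: wm m_closed)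
      finally show "z \<otimes> ((x \<otimes> w) \<otimes> y) = z \<otimes> (x \<otimes> (w \<otimes> y))" by simp
    qed (use x y w in \<open>simp_all add: m_closed\<close>)
  qed
  with zw c(2)[OF w] show ?thesis by auto
qed

lemma center_group: "group (center_struct L)"
proof (rule groupI)
  show "\<exists>y\<in>carrier (center_struct L). y \<otimes>\<^bsub>center_struct L\<^esub> x = \<one>\<^bsub>center_struct L\<^esub>"
    if "x \<in> carrier (center_struct L)" for x
    using that center_inverse by simp
qed (simp_all add: one_center center_m_closed l_one centerD(1) centerD(3))

text \<open>\<open>m_inv\<close> is a definite description, so uniqueness is required; in a loop it
  comes from left cancellation instead of associativity.\<close>

lemma inv_eqI:
  assumes "x \<in> carrier L" "y \<in> carrier L" "y \<otimes> x = \<one>" "x \<otimes> y = \<one>"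
  shows "x \<in> Units L" and "inv x = y"
proof -
  show "x \<in> Units L" using assms by (auto simp: Units_def)
  show "inv x = y" unfolding m_inv_def
  proof (rule the_equality)
    fix y' assume "y' \<in> carrier L \<and> x \<otimes> y' = \<one> \<and> y' \<otimes> x = \<one>"
    then show "y' = y" using assms l_cancel[of x y' y] by simp
  qed (use assms in simp)
qed

text \<open>Let \<open>c\<close> be the inverse of the norm \<open>s x \<otimes> x\<close> in the
  center. As \<open>c\<close> commutes and associates with everything, both products of
  \<open>c \<otimes> s x\<close> with \<open>x\<close> regroup to \<open>c\<close> times the norm,
  which does not depend on the order of \<open>x\<close> and \<open>s x\<close>.\<close>

lemma inv_via_central_involution:
  assumes s: "central_involution L s" and x: "x \<in> carrier L"
  shows "x \<in> Units L" and "inv x = inv\<^bsub>center_struct L\<^esub> (s x \<otimes> x) \<otimes> s x"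
proof -
  interpret Z: group "center_struct L" by (rule center_group)
  have sx: "s x \<in> carrier L"
    using s x unfolding central_involution_def involution_def anti_automorphism_def
    by (auto simp: bij_betw_def)
  have comm: "x \<otimes> s x = s x \<otimes> x" and n: "s x \<otimes> x \<in> center L"
    using s x by (auto simp: central_involution_def)
  define c where "c = inv\<^bsub>center_struct L\<^esub> (s x \<otimes> x)"
  have c: "c \<in> center L" and cn: "c \<otimes> (s x \<otimes> x) = \<one>"
    using Z.inv_closed[of "s x \<otimes> x"] Z.l_inv[of "s x \<otimes> x"] n by (simp_all add: c_def)
  note cc = centerD[OF c]
  have l: "(c \<otimes> s x) \<otimes> x = \<one>"
    using cc(3)[OF sx x] cn by simp
  have "x \<otimes> (c \<otimes> s x) = (c \<otimes> x) \<otimes> s x"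
    using cc(4)[OF x sx] cc(2)[OF x] by simp
  then have r: "x \<otimes> (c \<otimes> s x) = \<one>"
    using cc(3)[OF x sx] cn comm by simp
  show "x \<in> Units L" and "inv x = inv\<^bsub>center_struct L\<^esub> (s x \<otimes> x) \<otimes> s x"
    using inv_eqI[OF x m_closed[OF cc(1) sx] l r] by (simp_all add: c_def)
qed

text \<open>Solvability of \<open>y \<otimes> x = \<one>\<close> supplies the left inverses that
  \<open>groupI\<close> asks for.\<close>

lemma associative_imp_group:
  assumes "associative_op L"
  shows "group L"
proof (rule groupI)
  fix x assume "x \<in> carrier L"
  then show "\<exists>y\<in>carrier L. y \<otimes> x = \<one>"
    using r_solve[OF _ one_closed] by blast
qed (use assms in \<open>auto simp: associative_op_def m_closed one_closed l_one\<close>)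

end

section \<open>The double of a group\<close>

locale involution_double = group G for G :: "('a, 'b) monoid_scheme" (structure) +
  fixes s :: "'a \<Rightarrow> 'a" and \<epsilon> \<mu> :: 'a
  assumes central_inv: "central_involution G s"
    and eps_center: "\<epsilon> \<in> center G" and mu_center: "\<mu> \<in> center G"
    and s_eps: "s \<epsilon> = \<epsilon>" and s_mu: "s \<mu> = \<mu>"
    and eps_sq: "\<epsilon> \<otimes> \<epsilon> = \<one>"
begin

abbreviation "D \<equiv> double G s \<epsilon> \<mu>"
abbreviation "sD \<equiv> double_sharp G s \<epsilon>"

section \<open>Central elements, the involution and norms in \<open>G\<close>\<close>

lemma center_comm: "\<lbrakk>z \<in> center G; x \<in> carrier G\<rbrakk> \<Longrightarrow> z \<otimes> x = x \<otimes> z"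
  by (simp add: center_def)

lemma center_closed: "z \<in> center G \<Longrightarrow> z \<in> carrier G"
  by (simp add: center_def)

lemma center_lcomm:
  "\<lbrakk>z \<in> center G; x \<in> carrier G; y \<in> carrier G\<rbrakk> \<Longrightarrow> x \<otimes> (z \<otimes> y) = z \<otimes> (x \<otimes> y)"
  using center_comm[of z x] by (simp add: center_closed flip: m_assoc)

lemma group_centerI:
  "\<lbrakk>z \<in> carrier G; \<And>x. x \<in> carrier G \<Longrightarrow> z \<otimes> x = x \<otimes> z\<rbrakk> \<Longrightarrow> z \<in> center G"
  by (simp add: center_def m_assoc)

lemma center_mult: "\<lbrakk>z \<in> center G; w \<in> center G\<rbrakk> \<Longrightarrow> z \<otimes> w \<in> center G"
  by (rule group_centerI)
    (simp_all add: center_closed m_assoc center_comm[of w] center_lcomm[of z _ w])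

lemma s_closed [simp]: "x \<in> carrier G \<Longrightarrow> s x \<in> carrier G"
  using central_inv
  by (auto simp: central_involution_def involution_def anti_automorphism_def bij_betw_def)

lemma s_s [simp]: "x \<in> carrier G \<Longrightarrow> s (s x) = x"
  using central_inv by (auto simp: central_involution_def involution_def)

lemma s_mult [simp]: "\<lbrakk>x \<in> carrier G; y \<in> carrier G\<rbrakk> \<Longrightarrow> s (x \<otimes> y) = s y \<otimes> s x"
  using central_inv
  by (auto simp: central_involution_def involution_def anti_automorphism_def)

lemma s_one [simp]: "s \<one> = \<one>"
  using s_mult[of \<one> \<one>] by (metis l_cancel_one one_closed r_one s_closed)

text \<open>The involution reverses the product and centrality restores the order. This is how
  \<open>k\<close>, and later the norms of the double, are seen to be fixed by
  \<open>s\<close>.\<close>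

lemma s_fix_mult:
  "\<lbrakk>z \<in> center G; w \<in> center G; s z = z; s w = w\<rbrakk> \<Longrightarrow> s (z \<otimes> w) = z \<otimes> w"
  by (simp add: center_closed center_comm[of w])

lemma norm_center: "x \<in> carrier G \<Longrightarrow> s x \<otimes> x \<in> center G"
  using central_inv by (auto simp: central_involution_def)

lemma s_norm: "x \<in> carrier G \<Longrightarrow> s (s x \<otimes> x) = s x \<otimes> x"
  by simp

lemma norm_comm: "x \<in> carrier G \<Longrightarrow> x \<otimes> s x = s x \<otimes> x"
  using central_inv by (auto simp: central_involution_def)

text \<open>Both orders of \<open>x\<close> and \<open>s x\<close> give the same central norm.
  Stated for right-nested words, the rules collect an adjacent pair as
  \<open>s x \<otimes> x\<close> and carry it to the right end, which gives the words of the Moufang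
  identity a common form.\<close>

lemma norm_move:
  assumes "x \<in> carrier G" "y \<in> carrier G"
  shows "s x \<otimes> (x \<otimes> y) = y \<otimes> (s x \<otimes> x)"
    and "x \<otimes> (s x \<otimes> y) = y \<otimes> (s x \<otimes> x)"
  using assms center_comm[OF norm_center, of x y] norm_comm[of x]
  by (simp_all flip: m_assoc)

definition k where "k = \<mu> \<otimes> \<epsilon>"

lemma k_center: "k \<in> center G"
  by (simp add: k_def center_mult eps_center mu_center)

lemma k_closed [simp]: "k \<in> carrier G"
  by (rule center_closed[OF k_center])

lemma eps_closed [simp]: "\<epsilon> \<in> carrier G"
  by (rule center_closed[OF eps_center])

lemma eps_cancel: "x \<in> carrier G \<Longrightarrow> \<epsilon> \<otimes> (\<epsilon> \<otimes> x) = x"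
  by (simp add: eps_sq flip: m_assoc)

lemma s_k [simp]: "s k = k"
  unfolding k_def by (rule s_fix_mult[OF mu_center eps_center s_mu s_eps])

section \<open>The loop structure of the double\<close>

lemma carrier_D: "carrier D = carrier G \<times> UNIV"
  by (simp add: double_def)

lemma all_bit: "(\<forall>i::bit. P i) \<longleftrightarrow> P 0 \<and> P 1"
  by (metis (full_types) bit_not_one_iff)

text \<open>Splitting by degree turns a statement about the double into a conjunction of equations
  in \<open>G\<close>, which \<open>D_mult\<close> evaluates.\<close>

lemma ball_D: "(\<forall>p\<in>carrier D. P p) \<longleftrightarrow> (\<forall>x\<in>carrier G. P (x, 0) \<and> P (x, 1))"
  by (auto simp: carrier_D all_bit)

lemma bex_D: "(\<exists>p\<in>carrier D. P p) \<longleftrightarrow> (\<exists>x\<in>carrier G. P (x, 0) \<or> P (x, 1))"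
  using ball_D[of "\<lambda>p. \<not> P p"] by blast

lemma D_closed [simp]: "(x, i) \<in> carrier D \<longleftrightarrow> x \<in> carrier G"
  by (simp add: carrier_D)

lemma D_one: "\<one>\<^bsub>D\<^esub> = (\<one>, 0)"
  by (simp add: double_def)

lemma D_mult:
  "(x, 0) \<otimes>\<^bsub>D\<^esub> (y, 0) = (x \<otimes> y, 0)"
  "(x, 0) \<otimes>\<^bsub>D\<^esub> (y, 1) = (y \<otimes> x, 1)"
  "(x, 1) \<otimes>\<^bsub>D\<^esub> (y, 0) = (x \<otimes> s y, 1)"
  "(x, 1) \<otimes>\<^bsub>D\<^esub> (y, 1) = (k \<otimes> s y \<otimes> x, 0)"
  by (simp_all add: double_def k_def)

text \<open>With one factor and the degree of the other fixed, each product is a translation of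
  \<open>G\<close>, possibly composed with \<open>s\<close>, hence bijective. Injectivity comes from
  cancellation, surjectivity from solving the equations explicitly.\<close>

lemma D_loop: "loop D"
proof
  have closed: "\<forall>p\<in>carrier D. \<forall>q\<in>carrier D. p \<otimes>\<^bsub>D\<^esub> q \<in> carrier D"
    unfolding ball_D by (simp add: D_mult)
  then show "p \<otimes>\<^bsub>D\<^esub> q \<in> carrier D" if "p \<in> carrier D" "q \<in> carrier D" for p q
    using that by blast
  show "\<one>\<^bsub>D\<^esub> \<in> carrier D" by (simp add: D_one)
  have "\<forall>p\<in>carrier D. \<one>\<^bsub>D\<^esub> \<otimes>\<^bsub>D\<^esub> p = p \<and> p \<otimes>\<^bsub>D\<^esub> \<one>\<^bsub>D\<^esub> = p"
    unfolding ball_D by (simp add: D_mult D_one)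
  then show "\<one>\<^bsub>D\<^esub> \<otimes>\<^bsub>D\<^esub> p = p" "p \<otimes>\<^bsub>D\<^esub> \<one>\<^bsub>D\<^esub> = p" if "p \<in> carrier D" for p
    using that by auto
  have s_inj: "s x = s y \<longleftrightarrow> x = y" if "x \<in> carrier G" "y \<in> carrier G" for x y
    using that by (metis s_s)
  have linj: "\<forall>p\<in>carrier D. \<forall>q\<in>carrier D. \<forall>r\<in>carrier D. p \<otimes>\<^bsub>D\<^esub> q = p \<otimes>\<^bsub>D\<^esub> r \<longrightarrow> q = r"
    unfolding ball_D by (simp add: D_mult m_assoc s_inj)
  have rinj: "\<forall>p\<in>carrier D. \<forall>q\<in>carrier D. \<forall>r\<in>carrier D. q \<otimes>\<^bsub>D\<^esub> p = r \<otimes>\<^bsub>D\<^esub> p \<longrightarrow> q = r"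
    unfolding ball_D by (simp add: D_mult m_assoc s_inj)
  \<comment> \<open>Up to renaming, these are the equations in \<open>G\<close> that arise when
    either factor of a product is unknown; the degree of the unknown is forced by the other two. In
    the last one, \<open>a\<close> stands for \<open>s y\<close> with \<open>(y, 1)\<close> the
    given right factor.\<close>
  have lsol: "\<exists>u\<in>carrier G. u \<otimes> a = b" "\<exists>u\<in>carrier G. a \<otimes> u = b"
    "\<exists>u\<in>carrier G. a \<otimes> s u = b" "\<exists>u\<in>carrier G. k \<otimes> s u \<otimes> a = b" "\<exists>u\<in>carrier G. k \<otimes> a \<otimes> u = b"
    if ab: "a \<in> carrier G" "b \<in> carrier G" for a b
  proof -
    show "\<exists>u\<in>carrier G. u \<otimes> a = b"
      using ab by (intro bexI[of _ "b \<otimes> inv a"]) (simp_all add: m_assoc)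
    show "\<exists>u\<in>carrier G. a \<otimes> u = b"
      using ab by (intro bexI[of _ "inv a \<otimes> b"]) (simp_all flip: m_assoc)
    \<comment> \<open>Here and in the next equation the witness is \<open>s\<close> of the value
      that \<open>s u\<close> must take. Without \<open>s_mult\<close>, the double application of
      \<open>s\<close> collapses as a whole.\<close>
    show "\<exists>u\<in>carrier G. a \<otimes> s u = b"
      using ab by (intro bexI[of _ "s (inv a \<otimes> b)"]) (simp_all del: s_mult flip: m_assoc)
    show "\<exists>u\<in>carrier G. k \<otimes> s u \<otimes> a = b"
      using ab by (intro bexI[of _ "s (inv k \<otimes> b \<otimes> inv a)"])
        (simp_all add: m_assoc del: s_mult, simp flip: m_assoc)
    show "\<exists>u\<in>carrier G. k \<otimes> a \<otimes> u = b"
      using ab by (intro bexI[of _ "inv (k \<otimes> a) \<otimes> b"]) (simp_all flip: m_assoc)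
  qed
  have lsurj: "\<forall>p\<in>carrier D. \<forall>r\<in>carrier D. \<exists>q\<in>carrier D. p \<otimes>\<^bsub>D\<^esub> q = r"
    unfolding ball_D bex_D by (simp add: D_mult lsol)
  have rsurj: "\<forall>p\<in>carrier D. \<forall>r\<in>carrier D. \<exists>q\<in>carrier D. q \<otimes>\<^bsub>D\<^esub> p = r"
    unfolding ball_D bex_D by (simp add: D_mult lsol)
  show "bij_betw (\<lambda>q. p \<otimes>\<^bsub>D\<^esub> q) (carrier D) (carrier D)" if "p \<in> carrier D" for p
  proof (rule bij_betwI')
    show "\<exists>q\<in>carrier D. r = p \<otimes>\<^bsub>D\<^esub> q" if "r \<in> carrier D" for r
      using bspec[OF bspec[OF lsurj \<open>p \<in> carrier D\<close>] that] by auto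
  qed (use that closed linj in blast)+
  show "bij_betw (\<lambda>q. q \<otimes>\<^bsub>D\<^esub> p) (carrier D) (carrier D)" if "p \<in> carrier D" for p
  proof (rule bij_betwI')
    show "\<exists>q\<in>carrier D. r = q \<otimes>\<^bsub>D\<^esub> p" if "r \<in> carrier D" for r
      using bspec[OF bspec[OF rsurj \<open>p \<in> carrier D\<close>] that] by auto
  qed (use that closed rinj in blast)+
qed

text \<open>If an odd number of the three elements has degree 1, the two occurrences of
  \<open>a\<close> turn into \<open>a\<close> and \<open>s a\<close>, and the identity holds because
  their norm is central. Otherwise both occurrences stay \<open>a\<close>, and at most the central
  \<open>k\<close> has to move.\<close>

lemma D_moufang: "moufang_loop D"
proof -
  have "\<forall>i j l.
      ((a, i) \<otimes>\<^bsub>D\<^esub> (x, j)) \<otimes>\<^bsub>D\<^esub> ((y, l) \<otimes>\<^bsub>D\<^esub> (a, i)) =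
      (a, i) \<otimes>\<^bsub>D\<^esub> (((x, j) \<otimes>\<^bsub>D\<^esub> (y, l)) \<otimes>\<^bsub>D\<^esub> (a, i))"
    if [simp]: "a \<in> carrier G" "x \<in> carrier G" "y \<in> carrier G" for a x y
  proof -
    \<comment> \<open>Restricting \<open>u\<close> keeps these rewrite rules from looping on \<open>k \<otimes> k\<close>.\<close>
    have "u \<otimes> k = k \<otimes> u" "v \<in> carrier G \<Longrightarrow> u \<otimes> (k \<otimes> v) = k \<otimes> (u \<otimes> v)"
      if "u \<in> {a, x, y, s a, s x, s y}" for u v
      using that center_comm[OF k_center, of u] center_lcomm[OF k_center, of u v] by auto
    then show ?thesis
      unfolding all_bit by (simp add: D_mult m_assoc norm_move[of a] norm_comm[of a])
  qed
  then show ?thesis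
    by (auto simp: moufang_loop_def moufang_loop_axioms_def D_loop carrier_D)
qed

lemma D_associative_iff: "associative_op D \<longleftrightarrow> comm_group G"
proof
  assume a: "associative_op D"
  have "x \<otimes> y = y \<otimes> x" if "x \<in> carrier G" "y \<in> carrier G" for x y
  proof -
    have "((x, 0) \<otimes>\<^bsub>D\<^esub> (y, 0)) \<otimes>\<^bsub>D\<^esub> (\<one>, 1) = (x, 0) \<otimes>\<^bsub>D\<^esub> ((y, 0) \<otimes>\<^bsub>D\<^esub> (\<one>, 1))"
      using a that by (simp add: associative_op_def)
    then show ?thesis using that by (simp add: D_mult)
  qed
  then show "comm_group G" by (intro group_comm_groupI)
next
  assume "comm_group G"
  then interpret comm_group G .
  \<comment> \<open>For commutative \<open>G\<close>, up to powers of \<open>k\<close>, a product is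
    the left entry times the right one, with \<open>s\<close> applied to the latter when the left
    factor is odd. As \<open>s\<close> is multiplicative here and squares to the identity, both
    bracketings agree.\<close>
  show "associative_op D"
    unfolding associative_op_def ball_D by (simp add: D_mult m_ac)
qed

lemma D_central_involution: "central_involution D sD"
proof -
  interpret D: loop D by (rule D_loop)
  have invol: "\<forall>p\<in>carrier D. sD (sD p) = p"
    unfolding ball_D by (simp add: eps_cancel)
  have bij: "bij_betw sD (carrier D) (carrier D)"
    by (rule bij_betw_byWitness[where f' = sD, OF invol invol])
      (auto simp: image_subset_iff ball_D)
  \<comment> \<open>These rules carry both constants to the left, with \<epsilon> ahead of
    \<open>k\<close>.\<close>
  have move: "s x \<otimes> k = k \<otimes> s x" "x \<otimes> k = k \<otimes> x"
    "s x \<otimes> (x \<otimes> k) = k \<otimes> (s x \<otimes> x)" "s x \<otimes> (\<epsilon> \<otimes> y) = \<epsilon> \<otimes> (s x \<otimes> y)"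
    "x \<otimes> (\<epsilon> \<otimes> s y) = \<epsilon> \<otimes> (x \<otimes> s y)" "k \<otimes> (\<epsilon> \<otimes> x) = \<epsilon> \<otimes> (k \<otimes> x)"
    "s x \<otimes> \<epsilon> = \<epsilon> \<otimes> s x"
    if "x \<in> carrier G" "y \<in> carrier G" for x y
    using that center_comm[OF k_center, of x] center_comm[OF k_center, of "s x"]
      center_comm[OF eps_center, of "s x"] center_lcomm[OF k_center, of "s x" x]
    by (simp_all add: center_lcomm[OF eps_center])
  have anti: "\<forall>p\<in>carrier D. \<forall>q\<in>carrier D. sD (p \<otimes>\<^bsub>D\<^esub> q) = sD q \<otimes>\<^bsub>D\<^esub> sD p"
    unfolding ball_D by (simp add: D_mult m_assoc s_eps move eps_cancel)
  \<comment> \<open>Being fixed by \<open>s\<close> is essential: \<open>(z, 0)\<close> enters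
    \<open>(y, 1)\<close> from the left as \<open>z\<close> but from the right as
    \<open>s z\<close>.\<close>
  have z: "(z, 0) \<in> center D" if "z \<in> center G" "s z = z" for z
  proof (rule D.centerI)
    note zc = center_closed[OF that(1)] center_comm[OF that(1)] center_lcomm[OF that(1)]
    show "(z, 0) \<in> carrier D" using zc(1) by simp
    have "\<forall>p\<in>carrier D. (z, 0) \<otimes>\<^bsub>D\<^esub> p = p \<otimes>\<^bsub>D\<^esub> (z, 0)"
      unfolding ball_D using zc(1,2) that(2) by (simp add: D_mult)
    then show "(z, 0) \<otimes>\<^bsub>D\<^esub> p = p \<otimes>\<^bsub>D\<^esub> (z, 0)" if "p \<in> carrier D" for p
      using that by blast
    have "\<forall>p\<in>carrier D. \<forall>q\<in>carrier D.
        ((z, 0) \<otimes>\<^bsub>D\<^esub> p) \<otimes>\<^bsub>D\<^esub> q = (z, 0) \<otimes>\<^bsub>D\<^esub> (p \<otimes>\<^bsub>D\<^esub> q) \<and>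
        (p \<otimes>\<^bsub>D\<^esub> (z, 0)) \<otimes>\<^bsub>D\<^esub> q = p \<otimes>\<^bsub>D\<^esub> ((z, 0) \<otimes>\<^bsub>D\<^esub> q)"
      unfolding ball_D using zc(1) that(2)
      by (simp add: D_mult m_assoc zc(2)[symmetric] zc(3))
    then show "((z, 0) \<otimes>\<^bsub>D\<^esub> p) \<otimes>\<^bsub>D\<^esub> q = (z, 0) \<otimes>\<^bsub>D\<^esub> (p \<otimes>\<^bsub>D\<^esub> q)"
      "(p \<otimes>\<^bsub>D\<^esub> (z, 0)) \<otimes>\<^bsub>D\<^esub> q = p \<otimes>\<^bsub>D\<^esub> ((z, 0) \<otimes>\<^bsub>D\<^esub> q)"
      if "p \<in> carrier D" "q \<in> carrier D" for p q
      using that by blast+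
  qed
  \<comment> \<open>The norm of \<open>(x, 1)\<close> has entry
    \<open>\<epsilon> \<otimes> (k \<otimes> (s x \<otimes> x))\<close>, that is, \<mu> times the
    norm of \<open>x\<close>. All factors are central and fixed by \<open>s\<close>, so
    \<open>z\<close> applies; \<open>s_mult\<close> is off in the second pass so that
    \<open>s_norm\<close> and \<open>s_fix_mult\<close> see these products intact.\<close>
  have central: "\<forall>p\<in>carrier D. p \<otimes>\<^bsub>D\<^esub> sD p = sD p \<otimes>\<^bsub>D\<^esub> p \<and> p \<otimes>\<^bsub>D\<^esub> sD p \<in> center D"
    unfolding ball_D
    by (simp add: D_mult m_assoc s_eps norm_comm move eps_cancel)
      (simp add: z s_eps s_norm norm_center center_mult k_center eps_center s_fix_mult del: s_mult)
  show ?thesis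
    using bij anti invol central
    unfolding central_involution_def involution_def anti_automorphism_def by blast
qed

lemma D_commutative_iff:
  "(\<forall>p\<in>carrier D. \<forall>q\<in>carrier D. p \<otimes>\<^bsub>D\<^esub> q = q \<otimes>\<^bsub>D\<^esub> p) \<longleftrightarrow>
    comm_group G \<and> (\<forall>x\<in>carrier G. s x = x)"
proof
  assume c: "\<forall>p\<in>carrier D. \<forall>q\<in>carrier D. p \<otimes>\<^bsub>D\<^esub> q = q \<otimes>\<^bsub>D\<^esub> p"
  have "x \<otimes> y = y \<otimes> x" if "x \<in> carrier G" "y \<in> carrier G" for x y
    using bspec[OF bspec[OF c, of "(x, 0)"], of "(y, 0)"] that by (simp add: D_mult)
  moreover have "s x = x" if "x \<in> carrier G" for x
    using bspec[OF bspec[OF c, of "(x, 0)"], of "(\<one>, 1)"] that by (simp add: D_mult)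
  ultimately show "comm_group G \<and> (\<forall>x\<in>carrier G. s x = x)"
    by (auto intro: group_comm_groupI)
next
  assume a: "comm_group G \<and> (\<forall>x\<in>carrier G. s x = x)"
  then interpret comm_group G by simp
  show "\<forall>p\<in>carrier D. \<forall>q\<in>carrier D. p \<otimes>\<^bsub>D\<^esub> q = q \<otimes>\<^bsub>D\<^esub> p"
    unfolding ball_D using a by (simp add: D_mult m_ac)
qed

end

theorem theoremB2:
  fixes G :: "('a, 'b) monoid_scheme" and s :: "'a \<Rightarrow> 'a" and \<epsilon> \<mu> :: 'a
  assumes "group G"
    and "central_involution G s"
    and "\<epsilon> \<in> center G" and "\<mu> \<in> center G"
    and "s \<epsilon> = \<epsilon>" and "s \<mu> = \<mu>"
    and "\<epsilon> \<otimes>\<^bsub>G\<^esub> \<epsilon> = \<one>\<^bsub>G\<^esub>"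
  defines "D \<equiv> double G s \<epsilon> \<mu>"
    and "sD \<equiv> double_sharp G s \<epsilon>"
  shows "(comm_group G \<and> (\<forall>x\<in>carrier G. s x = x) \<longrightarrow> comm_group D) \<and>
    (comm_group G \<and> \<not> (\<forall>x\<in>carrier G. s x = x) \<longrightarrow> group D \<and> \<not> comm_group D) \<and>
    (\<not> comm_group G \<longrightarrow> moufang_loop D \<and> \<not> associative_op D) \<and>
    central_involution D sD \<and>
    group (center_struct D) \<and>
    (\<forall>x\<in>carrier D. x \<in> Units D \<and>
      inv\<^bsub>D\<^esub> x = inv\<^bsub>center_struct D\<^esub> (sD x \<otimes>\<^bsub>D\<^esub> x) \<otimes>\<^bsub>D\<^esub> sD x)"
proof -
  interpret involution_double G s \<epsilon> \<mu>
    using assms(1-7) by (simp add: involution_double_def involution_double_axioms_def)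
  interpret L: loop D
    unfolding D_def by (rule D_loop)
  have sD: "central_involution D sD"
    unfolding D_def sD_def by (rule D_central_involution)
  have grp: "group D" if "comm_group G"
    using that L.associative_imp_group D_associative_iff by (simp add: D_def)
  \<comment> \<open>Once \<open>G\<close> is commutative, \<open>grp\<close> makes \<open>D\<close>
    a group, and this equivalence separates the first two cases according to whether
    \<open>s\<close> is trivial.\<close>
  have comm: "comm_group D \<longleftrightarrow> comm_group G \<and> (\<forall>x\<in>carrier G. s x = x)"
  proof
    assume "comm_group D"
    then interpret C: comm_group D .
    show "comm_group G \<and> (\<forall>x\<in>carrier G. s x = x)"
      using C.m_comm D_commutative_iff by (simp add: D_def)
  next
    assume a: "comm_group G \<and> (\<forall>x\<in>carrier G. s x = x)"
    then show "comm_group D"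
      using grp D_commutative_iff by (auto intro: group.group_comm_groupI simp: D_def)
  qed
  show ?thesis
    using grp comm D_moufang D_associative_iff sD L.center_group
      L.inv_via_central_involution[OF sD]
    unfolding D_def by blast
qed

end
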